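(* Let $X$ be a Banach space and $1\le p<+\infty$. Suppose that $u\in S^p_{aa}(\mathbb{R},X)$ and $u_k\in S^p_{aa}(\mathbb{R},X)$ for all $k\in\mathbb{N}$. Then $\lim_{k\to+\infty}\|u_k-u\|_{S^p}=0$ if and only if the set $\{u_k:k\in\mathbb{N}\}$ is Stepanov $p$-uniformly integrable and $$\forall\varepsilon>0,\qquad \lim_{k\to\infty}\sup_{t\in\mathbb{R}}\mathrm{meas}\big(\{s\in(t,t+1):\|u_k(s)-u(s)\|\ge\varepsilon\}\big)=0.$$
   Context: $\mathrm{meas}$ is Lebesgue measure. $L^p(a,b;X)$ is the space of Bochner $p$-integrable functions on $(a,b)$ (functions equal a.e. are identified), and $L^p_{loc}(\mathbb{R},X)$ is the space of functions $u:\mathbb{R}\to X$ whose restriction to every bounded interval is in $L^p$ of that interval. The Bochner transform of $u\in L^p_{loc}(\mathbb{R},X)$ is the (continuous) map $u^b:\mathbb{R}\to L^p(0,1;X)$, $u^b(t)(\theta)=u(t+\theta)$, $\theta\in(0,1)$. For a Banach space $E$, a continuous function $u:\mathbb{R}\to E$ is almost automorphic if every sequence of real numbers has a subsequence $(t_k)$ for which there is a function $v:\mathbb{R}\to E$ with $\lim_k u(t+t_k)=v(t)$ and $\lim_k v(t-t_k)=u(t)$ for every $t\in\mathbb{R}$; the space of such functions is $AA(\mathbb{R},E)$. $S^p_{aa}(\mathbb{R},X)=\{u\in L^p_{loc}(\mathbb{R},X): u^b\in AA(\mathbb{R},L^p(0,1;X))\}$, with the norm $\|u\|_{S^p}=\sup_{t\in\mathbb{R}}\left(\int_0^1\|u(t+\theta)\|^p\,d\theta\right)^{1/p}$.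 For $t\in\mathbb{R}$, $\delta>0$, let $\mathcal{E}^t_\delta$ be the class of measurable sets $E\subset(t,t+1)$ with $\mathrm{meas}(E)\le\delta$. A subset $\mathcal{H}\subset L^p_{loc}(\mathbb{R},X)$ is Stepanov $p$-uniformly integrable if $\lim_{\delta\to0}\left(\sup_{u\in\mathcal{H}}\sup_{t\in\mathbb{R}}\sup_{E\in\mathcal{E}^t_\delta}\int_E\|u(s)\|^p\,ds\right)=0$. *)

theory Defs
  imports "HOL-Analysis.Analysis"
begin

section \<open>Bochner measurable functions and the spaces $L^p$\<close>

text \<open>
  The library's Bochner integral asks for a second countable value space. Here the values lie in an
  arbitrary Banach space, so measurability means strong (Bochner) measurability.
\<close>

definition Bochner_measurable_on :: "real set \<Rightarrow> (real \<Rightarrow> 'a::banach) \<Rightarrow> bool" where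
  "Bochner_measurable_on S f \<longleftrightarrow>
     (\<exists>s. (\<forall>n::nat. simple_function (lebesgue_on S) (s n)) \<and>
          (AE x in lebesgue_on S. (\<lambda>n. s n x) \<longlonglongrightarrow> f x))"

definition Lp_functions :: "real \<Rightarrow> real set \<Rightarrow> (real \<Rightarrow> 'a::banach) set" where
  "Lp_functions p S =
     {f. Bochner_measurable_on S f \<and> integrable (lebesgue_on S) (\<lambda>x. norm (f x) powr p)}"

definition Lp_norm :: "real \<Rightarrow> real set \<Rightarrow> (real \<Rightarrow> 'a::banach) \<Rightarrow> real" where
  "Lp_norm p S f = (LINT x|lebesgue_on S. norm (f x) powr p) powr (1 / p)"

definition Lp_class :: "real \<Rightarrow> real set \<Rightarrow> (real \<Rightarrow> 'a::banach) \<Rightarrow> (real \<Rightarrow> 'a) set" where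
  "Lp_class p S f = {g \<in> Lp_functions p S. AE x in lebesgue_on S. g x = f x}"

definition Lp_space :: "real \<Rightarrow> real set \<Rightarrow> (real \<Rightarrow> 'a::banach) set set" where
  "Lp_space p S = Lp_class p S ` Lp_functions p S"

text \<open>
  The distance of two classes is computed on chosen representatives; the lemma
  \<open>Lp_dist_class\<close> below shows that the choice is irrelevant.
\<close>

definition Lp_dist :: "real \<Rightarrow> real set \<Rightarrow> (real \<Rightarrow> 'a::banach) set \<Rightarrow> (real \<Rightarrow> 'a) set \<Rightarrow> real" where
  "Lp_dist p S F G = Lp_norm p S (\<lambda>x. (SOME f. f \<in> F) x - (SOME g. g \<in> G) x)"

definition Lp_topology :: "real \<Rightarrow> real set \<Rightarrow> (real \<Rightarrow> 'a::banach) set topology" where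
  "Lp_topology p S = Metric_space.mtopology (Lp_space p S) (Lp_dist p S)"

definition Lp_loc :: "real \<Rightarrow> (real \<Rightarrow> 'a::banach) set" where
  "Lp_loc p = {u. \<forall>a b. a < b \<longrightarrow> u \<in> Lp_functions p {a<..<b}}"


section \<open>Stepanov almost automorphic functions\<close>

definition Bochner_transform :: "real \<Rightarrow> (real \<Rightarrow> 'a::banach) \<Rightarrow> real \<Rightarrow> (real \<Rightarrow> 'a) set" where
  "Bochner_transform p u t = Lp_class p {0<..<1} (\<lambda>\<theta>. u (t + \<theta>))"

text \<open>
  Almost automorphy involves only the topology of the Banach space of values. It is stated for an
  abstract topology because the elements of $L^p(0,1;X)$ do not form a type.
\<close>

definition almost_automorphic :: "'e topology \<Rightarrow> (real \<Rightarrow> 'e) \<Rightarrow> bool" where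
  "almost_automorphic T u \<longleftrightarrow>
     continuous_map euclideanreal T u \<and>
     (\<forall>s :: nat \<Rightarrow> real. \<exists>r v. strict_mono r \<and>
        (\<forall>t. limitin T (\<lambda>k. u (t + s (r k))) (v t) sequentially \<and>
             limitin T (\<lambda>k. v (t - s (r k))) (u t) sequentially))"

definition Sp_aa :: "real \<Rightarrow> (real \<Rightarrow> 'a::banach) set" where
  "Sp_aa p = {u \<in> Lp_loc p. almost_automorphic (Lp_topology p {0<..<1}) (Bochner_transform p u)}"

definition Stepanov_norm :: "real \<Rightarrow> (real \<Rightarrow> 'a::banach) \<Rightarrow> ennreal" where
  "Stepanov_norm p u = (SUP t. ennreal (Lp_norm p {0<..<1} (\<lambda>\<theta>. u (t + \<theta>))))"

definition small_sets :: "real \<Rightarrow> real \<Rightarrow> real set set" where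
  "small_sets t \<delta> = {E \<in> sets lebesgue. E \<subseteq> {t<..<t + 1} \<and> emeasure lebesgue E \<le> ennreal \<delta>}"

definition Stepanov_uniformly_integrable :: "real \<Rightarrow> (real \<Rightarrow> 'a::banach) set \<Rightarrow> bool" where
  "Stepanov_uniformly_integrable p H \<longleftrightarrow>
     H \<subseteq> Lp_loc p \<and>
     ((\<lambda>\<delta>. SUP u\<in>H. SUP t. SUP E\<in>small_sets t \<delta>.
         \<integral>\<^sup>+s\<in>E. ennreal (norm (u s) powr p) \<partial>lebesgue) \<longlongrightarrow> 0) (at_right 0)"


section \<open>$L^p$ is a metric space\<close>

lemma Bochner_measurable_on_norm:
  fixes f :: "real \<Rightarrow> 'a::banach"
  assumes S: "S \<in> sets lebesgue" and f: "Bochner_measurable_on S f"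
  shows "(\<lambda>x. norm (f x)) \<in> borel_measurable (lebesgue_on S)"
proof -
  obtain s where s: "\<And>n::nat. simple_function (lebesgue_on S) (s n)"
    and lim: "AE x in lebesgue_on S. (\<lambda>n. s n x) \<longlonglongrightarrow> f x"
    using f unfolding Bochner_measurable_on_def by blast
  have "(\<lambda>x. norm (s n x)) \<in> borel_measurable (lebesgue_on S)" for n
    using simple_function_compose1[OF s, of norm n] by (rule borel_measurable_simple_function)
  then have m: "(\<lambda>x. if x \<in> S then norm (s n x) else 0) \<in> borel_measurable lebesgue" for n
    using borel_measurable_if_I S by blast
  have ae: "AE x in lebesgue. x \<in> S \<longrightarrow> (\<lambda>n. s n x) \<longlonglongrightarrow> f x"
    using lim S by (simp add: AE_restrict_space_iff)
  have "(\<lambda>x. lim (\<lambda>n. if x \<in> S then norm (s n x) else 0)) \<in> borel_measurable lebesgue"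
    using m by (intro borel_measurable_lim_metric)
  moreover have "AE x in lebesgue. lim (\<lambda>n. if x \<in> S then norm (s n x) else 0)
      = (if x \<in> S then norm (f x) else 0)"
    using ae
  proof (eventually_elim)
    case (elim x)
    then show ?case by (auto intro!: limI tendsto_norm)
  qed
  ultimately have "(\<lambda>x. if x \<in> S then norm (f x) else 0) \<in> borel_measurable lebesgue"
    by (rule borel_measurable_AE)
  then show ?thesis using borel_measurable_if[OF S] by blast
qed

lemma Bochner_measurable_on_diff:
  fixes f g :: "real \<Rightarrow> 'a::banach"
  assumes "Bochner_measurable_on S f" "Bochner_measurable_on S g"
  shows "Bochner_measurable_on S (\<lambda>x. f x - g x)"
proof -
  obtain s where s: "\<And>n::nat. simple_function (lebesgue_on S) (s n)"
    and ls: "AE x in lebesgue_on S. (\<lambda>n. s n x) \<longlonglongrightarrow> f x"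
    using assms(1) unfolding Bochner_measurable_on_def by blast
  obtain r where r: "\<And>n::nat. simple_function (lebesgue_on S) (r n)"
    and lr: "AE x in lebesgue_on S. (\<lambda>n. r n x) \<longlonglongrightarrow> g x"
    using assms(2) unfolding Bochner_measurable_on_def by blast
  have "AE x in lebesgue_on S. (\<lambda>n. s n x - r n x) \<longlonglongrightarrow> f x - g x"
    using ls lr by eventually_elim (rule tendsto_diff)
  moreover have "simple_function (lebesgue_on S) (\<lambda>x. s n x - r n x)" for n
    by (intro simple_function_diff s r)
  ultimately show ?thesis
    unfolding Bochner_measurable_on_def by (intro exI[of _ "\<lambda>n x. s n x - r n x"]) auto
qed

lemma powr_add_le_weighted:
  fixes x y a b p :: real
  assumes "1 \<le> p" "0 < a" "0 < b" "0 \<le> x" "0 \<le> y"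
  shows "(x + y) powr p \<le>
    (a + b) powr p * (a / (a + b) * (x powr p / a powr p) + b / (a + b) * (y powr p / b powr p))"
proof -
  have conv: "convex_on {0..} (\<lambda>x::real. x powr p)"
  proof (rule convex_onI)
    fix t u v :: real
    assume t: "0 < t" "t < 1" and uv: "u \<in> {0..}" "v \<in> {0..}"
    have le: "c powr p \<le> c" if "0 < c" "c < 1" for c :: real
      using powr_mono'[of 1 p c] that assms(1) by simp
    show "((1 - t) *\<^sub>R u + t *\<^sub>R v) powr p \<le> (1 - t) * u powr p + t * v powr p"
    proof (cases "u = 0 \<or> v = 0")
      case True
      then show ?thesis
      proof
        assume "u = 0"
        then show ?thesis
          using le[OF t] t uv by (auto simp: powr_mult intro!: mult_right_mono)
      next
        assume "v = 0"
        then show ?thesis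
          using le[of "1 - t"] t uv by (auto simp: powr_mult intro!: mult_right_mono)
      qed
    next
      case False
      then show ?thesis
        using convex_onD[OF powr_convex[OF assms(1)], of t u v] t uv by auto
    qed
  qed simp
  define l where "l = b / (a + b)"
  have l: "0 \<le> l" "l \<le> 1" "1 - l = a / (a + b)"
    using assms by (auto simp: l_def field_simps)
  have "(1 - l) * (x / a) = x / (a + b)" "l * (y / b) = y / (a + b)"
    unfolding l(3) unfolding l_def using assms by simp_all
  then have "x + y = (a + b) * ((1 - l) * (x / a) + l * (y / b))"
    using assms by (simp add: add_divide_distrib[symmetric])
  then have "(x + y) powr p = (a + b) powr p * ((1 - l) * (x / a) + l * (y / b)) powr p"
    using assms l by (simp add: powr_mult)
  also have "((1 - l) * (x / a) + l * (y / b)) powr p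
      \<le> (1 - l) * (x / a) powr p + l * (y / b) powr p"
    using convex_onD[OF conv, of l "x / a" "y / b"] l assms by auto
  also have "\<dots> = a / (a + b) * (x powr p / a powr p) + b / (a + b) * (y powr p / b powr p)"
    unfolding l(3) unfolding l_def using assms by (simp add: powr_divide)
  finally show ?thesis using assms by (simp add: mult_left_mono)
qed

lemma Lp_norm_nonneg [simp]: "0 \<le> Lp_norm p S f"
  by (simp add: Lp_norm_def)

lemma Lp_norm_powr:
  assumes "1 \<le> p"
  shows "Lp_norm p S f powr p = (LINT x|lebesgue_on S. norm (f x) powr p)"
  using assms by (simp add: Lp_norm_def powr_powr integral_nonneg_AE)

lemma Lp_norm_cong_AE:
  assumes S: "S \<in> sets lebesgue"
    and "Bochner_measurable_on S f" "Bochner_measurable_on S g"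
    and "AE x in lebesgue_on S. f x = g x"
  shows "Lp_norm p S f = Lp_norm p S g"
proof -
  note [measurable] = assms(2,3)[THEN Bochner_measurable_on_norm[OF S]]
  have "(LINT x|lebesgue_on S. norm (f x) powr p) = (LINT x|lebesgue_on S. norm (g x) powr p)"
    using assms(4) by (intro integral_cong_AE) auto
  then show ?thesis by (simp add: Lp_norm_def)
qed

lemma Lp_diff_and_triangle:
  fixes f g h :: "real \<Rightarrow> 'a::banach"
  assumes S: "S \<in> sets lebesgue" and p: "1 \<le> p"
    and f: "f \<in> Lp_functions p S" and g: "g \<in> Lp_functions p S"
  shows "(\<lambda>x. f x - g x) \<in> Lp_functions p S"
    and "Lp_norm p S (\<lambda>x. f x - g x) \<le> Lp_norm p S f + Lp_norm p S g"
proof -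
  have If: "integrable (lebesgue_on S) (\<lambda>x. norm (f x) powr p)"
    and Ig: "integrable (lebesgue_on S) (\<lambda>x. norm (g x) powr p)"
    and Bf: "Bochner_measurable_on S f" and Bg: "Bochner_measurable_on S g"
    using f g by (auto simp: Lp_functions_def)
  note B = Bochner_measurable_on_diff[OF Bf Bg]
  note [measurable] = Bochner_measurable_on_norm[OF S B]
  let ?w = "\<lambda>a b x. (a + b) powr p *
    (a / (a + b) * (norm (f x) powr p / a powr p) + b / (a + b) * (norm (g x) powr p / b powr p))"
  have Iw: "integrable (lebesgue_on S) (?w a b)" for a b
    using If Ig by auto
  have le: "norm (f x - g x) powr p \<le> ?w a b x" if "0 < a" "0 < b" for a b x
  proof -
    have "norm (f x - g x) powr p \<le> (norm (f x) + norm (g x)) powr p"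
      using p by (intro powr_mono2 norm_triangle_ineq4) auto
    also have "\<dots> \<le> ?w a b x"
      using that p by (intro powr_add_le_weighted) auto
    finally show ?thesis .
  qed
  have I: "integrable (lebesgue_on S) (\<lambda>x. norm (f x - g x) powr p)"
  proof (rule Bochner_Integration.integrable_bound[OF Iw[of 1 1]])
    show "AE x in lebesgue_on S. norm (norm (f x - g x) powr p) \<le> norm (?w 1 1 x)"
    proof (rule AE_I2)
      fix x
      show "norm (norm (f x - g x) powr p) \<le> norm (?w 1 1 x)"
        using order_trans[OF le[of 1 1 x] abs_ge_self] by simp
    qed
  qed measurable
  then show "(\<lambda>x. f x - g x) \<in> Lp_functions p S"
    using B by (simp add: Lp_functions_def)
  show "Lp_norm p S (\<lambda>x. f x - g x) \<le> Lp_norm p S f + Lp_norm p S g"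
  proof (rule field_le_epsilon)
    fix e :: real assume e: "0 < e"
    define a where "a = Lp_norm p S f + e / 2"
    define b where "b = Lp_norm p S g + e / 2"
    have ab: "0 < a" "0 < b"
      using e by (auto simp: a_def b_def intro: add_nonneg_pos)
    have fa: "(LINT x|lebesgue_on S. norm (f x) powr p) \<le> a powr p"
      unfolding Lp_norm_powr[OF p, symmetric] using e p by (intro powr_mono2) (auto simp: a_def)
    have gb: "(LINT x|lebesgue_on S. norm (g x) powr p) \<le> b powr p"
      unfolding Lp_norm_powr[OF p, symmetric] using e p by (intro powr_mono2) (auto simp: b_def)
    have "(LINT x|lebesgue_on S. norm (f x - g x) powr p) \<le> (LINT x|lebesgue_on S. ?w a b x)"
      by (intro integral_mono I Iw le ab)
    also have "\<dots> = (a + b) powr p *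
        (a / (a + b) * ((LINT x|lebesgue_on S. norm (f x) powr p) / a powr p)
         + b / (a + b) * ((LINT x|lebesgue_on S. norm (g x) powr p) / b powr p))"
      using If Ig by simp
    also have "\<dots> \<le> (a + b) powr p * (a / (a + b) * 1 + b / (a + b) * 1)"
      using ab fa gb by (intro mult_left_mono add_mono) (auto simp: divide_simps)
    also have "\<dots> = (a + b) powr p"
      using ab by (simp add: add_divide_distrib[symmetric])
    finally have "Lp_norm p S (\<lambda>x. f x - g x) \<le> ((a + b) powr p) powr (1 / p)"
      unfolding Lp_norm_def using p by (intro powr_mono2) (auto intro!: integral_nonneg_AE)
    also have "\<dots> = a + b"
      using ab p by (simp add: powr_powr)
    finally show "Lp_norm p S (\<lambda>x. f x - g x) \<le> Lp_norm p S f + Lp_norm p S g + e"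
      by (simp add: a_def b_def)
  qed
qed

lemma Lp_class_some:
  assumes "f \<in> Lp_functions p S"
  shows "(SOME g. g \<in> Lp_class p S f) \<in> Lp_class p S f"
proof -
  have "f \<in> Lp_class p S f" using assms by (simp add: Lp_class_def)
  then show ?thesis by (rule someI[where P = "\<lambda>g. g \<in> Lp_class p S f"])
qed

lemma Lp_dist_class:
  assumes S: "S \<in> sets lebesgue"
    and f: "f \<in> Lp_functions p S" and g: "g \<in> Lp_functions p S"
  shows "Lp_dist p S (Lp_class p S f) (Lp_class p S g) = Lp_norm p S (\<lambda>x. f x - g x)"
proof -
  let ?f = "SOME h. h \<in> Lp_class p S f" and ?g = "SOME h. h \<in> Lp_class p S g"
  have f': "?f \<in> Lp_functions p S" "AE x in lebesgue_on S. ?f x = f x"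
    using Lp_class_some[OF f] unfolding Lp_class_def by auto
  have g': "?g \<in> Lp_functions p S" "AE x in lebesgue_on S. ?g x = g x"
    using Lp_class_some[OF g] unfolding Lp_class_def by auto
  have "AE x in lebesgue_on S. ?f x - ?g x = f x - g x"
    using f'(2) g'(2) by eventually_elim simp
  moreover have "Bochner_measurable_on S (\<lambda>x. ?f x - ?g x)" "Bochner_measurable_on S (\<lambda>x. f x - g x)"
    using f f'(1) g g'(1) by (auto simp: Lp_functions_def intro!: Bochner_measurable_on_diff)
  ultimately show ?thesis
    unfolding Lp_dist_def by (intro Lp_norm_cong_AE S)
qed

lemma Lp_class_eq_iff:
  assumes f: "f \<in> Lp_functions p S" and g: "g \<in> Lp_functions p S"
  shows "Lp_class p S f = Lp_class p S g \<longleftrightarrow> (AE x in lebesgue_on S. f x = g x)"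
proof
  assume "Lp_class p S f = Lp_class p S g"
  moreover have "f \<in> Lp_class p S f" using f by (simp add: Lp_class_def)
  ultimately show "AE x in lebesgue_on S. f x = g x" by (simp add: Lp_class_def)
next
  assume eq: "AE x in lebesgue_on S. f x = g x"
  have "(AE x in lebesgue_on S. h x = f x) \<longleftrightarrow> (AE x in lebesgue_on S. h x = g x)" for h
  proof
    assume "AE x in lebesgue_on S. h x = f x"
    with eq show "AE x in lebesgue_on S. h x = g x" by eventually_elim simp
  next
    assume "AE x in lebesgue_on S. h x = g x"
    with eq show "AE x in lebesgue_on S. h x = f x" by eventually_elim simp
  qed
  then show "Lp_class p S f = Lp_class p S g" by (simp add: Lp_class_def)
qed

lemma Metric_space_Lp:
  assumes S: "S \<in> sets lebesgue" and p: "1 \<le> p"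
  shows "Metric_space (Lp_space p S :: (real \<Rightarrow> 'a::banach) set set) (Lp_dist p S)"
proof
  fix F G :: "(real \<Rightarrow> 'a) set"
  show "0 \<le> Lp_dist p S F G" by (simp add: Lp_dist_def)
  show "Lp_dist p S F G = Lp_dist p S G F"
    unfolding Lp_dist_def Lp_norm_def by (simp add: norm_minus_commute)
next
  fix F G :: "(real \<Rightarrow> 'a) set"
  assume "F \<in> Lp_space p S" "G \<in> Lp_space p S"
  then obtain f g where f: "f \<in> Lp_functions p S" and g: "g \<in> Lp_functions p S"
    and F: "F = Lp_class p S f" and G: "G = Lp_class p S g"
    by (auto simp: Lp_space_def)
  have I: "integrable (lebesgue_on S) (\<lambda>x. norm (f x - g x) powr p)"
    using Lp_diff_and_triangle(1)[OF S p f g] by (simp add: Lp_functions_def)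
  have "Lp_dist p S F G = 0 \<longleftrightarrow> (LINT x|lebesgue_on S. norm (f x - g x) powr p) = 0"
    using p unfolding F G Lp_dist_class[OF S f g] by (simp add: Lp_norm_def)
  also have "\<dots> \<longleftrightarrow> (AE x in lebesgue_on S. f x = g x)"
    by (subst integral_nonneg_eq_0_iff_AE[OF I]) auto
  also have "\<dots> \<longleftrightarrow> F = G"
    unfolding F G by (rule Lp_class_eq_iff[OF f g, symmetric])
  finally show "Lp_dist p S F G = 0 \<longleftrightarrow> F = G" .
next
  fix F G H :: "(real \<Rightarrow> 'a) set"
  assume "F \<in> Lp_space p S" "G \<in> Lp_space p S" "H \<in> Lp_space p S"
  then obtain f g h where f: "f \<in> Lp_functions p S" and g: "g \<in> Lp_functions p S"
    and h: "h \<in> Lp_functions p S"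
    and eqs: "F = Lp_class p S f" "G = Lp_class p S g" "H = Lp_class p S h"
    by (auto simp: Lp_space_def)
  have "Lp_norm p S (\<lambda>x. f x - h x) = Lp_norm p S (\<lambda>x. (f x - g x) - (h x - g x))"
    by simp
  also have "\<dots> \<le> Lp_norm p S (\<lambda>x. f x - g x) + Lp_norm p S (\<lambda>x. h x - g x)"
    by (intro Lp_diff_and_triangle(2)[OF S p] Lp_diff_and_triangle(1)[OF S p] f g h)
  also have "Lp_norm p S (\<lambda>x. h x - g x) = Lp_norm p S (\<lambda>x. g x - h x)"
    by (simp add: Lp_norm_def norm_minus_commute)
  finally show "Lp_dist p S F H \<le> Lp_dist p S F G + Lp_dist p S G H"
    unfolding eqs using f g h by (simp add: Lp_dist_class[OF S])
qed

end

theory Submission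
  imports Defs
begin

text \<open>
  The point is that a single $u \in S^p_{aa}$ is Stepanov $p$-uniformly integrable: otherwise there
  are $t_n$ and sets $E_n \subset (t_n, t_n + 1)$ with measure tending to $0$ on which $\|u\|^p$ has
  integral at least $\varepsilon$; along a subsequence $u(t_n + \cdot)$ converges in $L^p(0,1;X)$ to
  some $g$, and the absolute continuity of $\int \|g\|^p$ gives a contradiction. The equivalence is
  then Vitali's argument, made uniform in $t$.
\<close>

section \<open>Absolute continuity of the integral\<close>

text \<open>Truncate \<open>h\<close> at a level n. The excess above n has small integral for large
  n, by dominated convergence with majorant \<open>h\<close>; the truncated part contributes at most
  n times the measure of \<open>E\<close>.\<close>

lemma nn_integral_small_on_small_sets:
  fixes h :: "'b \<Rightarrow> ennreal"
  assumes h [measurable]: "h \<in> borel_measurable M" and fin: "(\<integral>\<^sup>+x. h x \<partial>M) < \<infinity>" and e: "0 < (e::real)"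
  obtains \<delta> :: real where "0 < \<delta>"
    "\<And>E. E \<in> sets M \<Longrightarrow> emeasure M E \<le> ennreal \<delta> \<Longrightarrow> (\<integral>\<^sup>+x\<in>E. h x \<partial>M) \<le> ennreal e"
proof -
  have "AE x in M. h x \<noteq> \<infinity>"
    using fin by (intro nn_integral_PInf_AE) auto
  then have ae: "AE x in M. (\<lambda>n::nat. h x - min (h x) (of_nat n)) \<longlonglongrightarrow> 0"
  proof eventually_elim
    case (elim x)
    then obtain N where N: "h x < of_nat N"
      using ennreal_Ex_less_of_nat[of "h x"] by (auto simp: less_top)
    \<comment> \<open>Finiteness of \<open>h x\<close> enters here: in \<open>ennreal\<close> the
      difference of infinity with itself is infinity, not 0.\<close>
    have "h x - min (h x) (of_nat n) = 0" if "N \<le> n" for n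
    proof -
      have "h x \<le> of_nat n"
        using N that by (meson less_imp_le of_nat_mono order_trans)
      then show ?thesis using elim by (simp add: min_def)
    qed
    then show ?case
      by (intro tendsto_eventually eventually_sequentiallyI[of N]) auto
  qed
  have "(\<lambda>n. \<integral>\<^sup>+x. h x - min (h x) (of_nat n) \<partial>M) \<longlonglongrightarrow> (\<integral>\<^sup>+x. 0 \<partial>M)"
    by (rule nn_integral_dominated_convergence[where w = h]) (use fin ae in auto)
  then have "\<forall>\<^sub>F n in sequentially. (\<integral>\<^sup>+x. h x - min (h x) (of_nat n) \<partial>M) < ennreal (e / 2)"
    using e by (intro order_tendstoD(2)) auto
  then obtain n :: nat where n: "(\<integral>\<^sup>+x. h x - min (h x) (of_nat n) \<partial>M) < ennreal (e / 2)"
    by (auto simp: eventually_sequentially)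
  \<comment> \<open>Chosen so that n times \<delta> is at most e / 2; the \<open>+ 1\<close> keeps
    the denominator positive when n = 0.\<close>
  define \<delta> where "\<delta> = e / (2 * (real n + 1))"
  have nd: "real n * \<delta> \<le> e / 2"
    using e by (simp add: \<delta>_def field_simps)
  show ?thesis
  proof
    show "0 < \<delta>" using e by (simp add: \<delta>_def)
  next
    fix E assume E [measurable]: "E \<in> sets M" and small: "emeasure M E \<le> ennreal \<delta>"
    have le: "h x * indicator E x \<le> (h x - min (h x) (of_nat n)) + of_nat n * indicator E x" for x
    proof (cases "h x \<le> of_nat n")
      case False
      then have "h x = (h x - of_nat n) + of_nat n"
        by (simp add: diff_add_cancel_ennreal)
      then show ?thesis using False by (auto simp: min_def split: split_indicator)
    qed (auto intro: add_increasing split: split_indicator)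
    have "(\<integral>\<^sup>+x\<in>E. h x \<partial>M) \<le> (\<integral>\<^sup>+x. (h x - min (h x) (of_nat n)) + of_nat n * indicator E x \<partial>M)"
      by (intro nn_integral_mono le)
    also have "\<dots> = (\<integral>\<^sup>+x. h x - min (h x) (of_nat n) \<partial>M) + of_nat n * emeasure M E"
      by (subst nn_integral_add) (auto simp: nn_integral_cmult_indicator)
    also have "\<dots> \<le> ennreal (e / 2) + of_nat n * ennreal \<delta>"
      using n small by (intro add_mono mult_left_mono) auto
    also have "of_nat n * ennreal \<delta> = ennreal (real n * \<delta>)"
      by (simp add: ennreal_mult' ennreal_of_nat_eq_real_of_nat)
    also have "ennreal (e / 2) + ennreal (real n * \<delta>) \<le> ennreal (e / 2) + ennreal (e / 2)"
      using nd by (intro add_left_mono ennreal_leI)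
    also have "\<dots> = ennreal e"
      using e by (simp flip: ennreal_plus)
    finally show "(\<integral>\<^sup>+x\<in>E. h x \<partial>M) \<le> ennreal e" .
  qed
qed

section \<open>Integrals of the p-th power of the norm, and their translates\<close>

text \<open>The p-th power of the L^p norm over \<open>E\<close>, taken in \<open>ennreal\<close> so
  that comparisons carry no integrability conditions. It is the expression inside the suprema of
  \<open>Stepanov_uniformly_integrable\<close>.\<close>

definition Lp_mass :: "real \<Rightarrow> real set \<Rightarrow> (real \<Rightarrow> 'a::banach) \<Rightarrow> ennreal" where
  "Lp_mass p E f = (\<integral>\<^sup>+x\<in>E. ennreal (norm (f x) powr p) \<partial>lebesgue)"

lemma Lp_mass_lebesgue_on:
  assumes "E \<in> sets lebesgue"
  shows "Lp_mass p E f = (\<integral>\<^sup>+x. ennreal (norm (f x) powr p) \<partial>lebesgue_on E)"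
  using assms by (simp add: Lp_mass_def nn_integral_restrict_space)

lemma Lp_mass_mono_set:
  assumes "E \<subseteq> F"
  shows "Lp_mass p E f \<le> Lp_mass p F f"
  unfolding Lp_mass_def using assms by (intro nn_integral_mono) (auto split: split_indicator)

text \<open>Convexity of the p-th power with weights 1/2 gives (a + b)^p <= 2^p (a^p / 2 + b^p / 2);
  the factor 1/2 is then dropped. Stating it for any \<open>h\<close> dominated by a sum of norms
  covers both a difference f - g and a splitting h = (h - g) + g.\<close>

lemma Lp_mass_le_add:
  assumes p: "1 \<le> p" and E: "E \<in> sets lebesgue"
    and f: "(\<lambda>x. norm (f x)) \<in> borel_measurable (lebesgue_on E)"
    and g: "(\<lambda>x. norm (g x)) \<in> borel_measurable (lebesgue_on E)"
    and le: "\<And>x. x \<in> E \<Longrightarrow> norm (h x) \<le> norm (f x) + norm (g x)"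
  shows "Lp_mass p E h \<le> ennreal (2 powr p) * (Lp_mass p E f + Lp_mass p E g)"
proof -
  note [measurable] = f g
  have "Lp_mass p E h \<le> (\<integral>\<^sup>+x. ennreal (2 powr p) *
      (ennreal (norm (f x) powr p) + ennreal (norm (g x) powr p)) \<partial>lebesgue_on E)"
    unfolding Lp_mass_lebesgue_on[OF E]
  proof (rule nn_integral_mono)
    fix x assume "x \<in> space (lebesgue_on E)"
    then have "x \<in> E" by (simp add: space_restrict_space)
    then have "norm (h x) powr p \<le> (norm (f x) + norm (g x)) powr p"
      using p le by (intro powr_mono2) auto
    also have "\<dots> \<le> 2 powr p * (norm (f x) powr p / 2 + norm (g x) powr p / 2)"
      using powr_add_le_weighted[OF p, of 1 1 "norm (f x)" "norm (g x)"] by simp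
    also have "\<dots> \<le> 2 powr p * (norm (f x) powr p + norm (g x) powr p)"
      using powr_ge_zero[of "norm (f x)" p] powr_ge_zero[of "norm (g x)" p]
      by (intro mult_left_mono) (linarith, simp)
    finally show "ennreal (norm (h x) powr p)
        \<le> ennreal (2 powr p) * (ennreal (norm (f x) powr p) + ennreal (norm (g x) powr p))"
      by (simp add: ennreal_leI flip: ennreal_plus ennreal_mult')
  qed
  also have "\<dots> = ennreal (2 powr p) * (Lp_mass p E f + Lp_mass p E g)"
    unfolding Lp_mass_lebesgue_on[OF E]
    by (subst nn_integral_cmult, measurable, subst nn_integral_add) auto
  finally show ?thesis .
qed

text \<open>\<open>Lp_loc\<close> gives measurability on bounded intervals only; the norm on the
  whole line is the pointwise limit of its cut-offs to growing intervals.\<close>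

lemma Lp_loc_norm_measurable:
  fixes w :: "real \<Rightarrow> 'a::banach"
  assumes w: "w \<in> Lp_loc p"
  shows "(\<lambda>x. norm (w x)) \<in> borel_measurable lebesgue"
proof (rule borel_measurable_LIMSEQ_real)
  fix n :: nat
  \<comment> \<open>\<open>Lp_loc\<close> speaks of intervals with a < b, so the \<open>+ 1\<close>
    is there for n = 0.\<close>
  have "w \<in> Lp_functions p {- (real n + 1)<..<real n + 1}"
    using w by (auto simp: Lp_loc_def)
  then have "(\<lambda>x. norm (w x)) \<in> borel_measurable (lebesgue_on {- (real n + 1)<..<real n + 1})"
    by (intro Bochner_measurable_on_norm) (auto simp: Lp_functions_def)
  then show "(\<lambda>x. if x \<in> {- (real n + 1)<..<real n + 1} then norm (w x) else 0)
      \<in> borel_measurable lebesgue"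
    by (intro borel_measurable_if_I) auto
next
  fix x :: real
  obtain N :: nat where N: "\<bar>x\<bar> < real N"
    using reals_Archimedean2 by blast
  show "(\<lambda>n. if x \<in> {- (real n + 1)<..<real n + 1} then norm (w x) else 0) \<longlonglongrightarrow> norm (w x)"
    by (rule tendsto_eventually, rule eventually_sequentiallyI[of N]) (use N in auto)
qed

lemma Lp_loc_norm_measurable_on:
  assumes "w \<in> Lp_loc p"
  shows "(\<lambda>x. norm (w x)) \<in> borel_measurable (lebesgue_on E)"
  using Lp_loc_norm_measurable[OF assms] by (rule measurable_restrict_space1)

lemma Lp_loc_norm_translate_measurable_on:
  assumes "w \<in> Lp_loc p"
  shows "(\<lambda>x. norm (w (t + x))) \<in> borel_measurable (lebesgue_on E)"
proof (rule measurable_restrict_space1)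
  show "(\<lambda>x. norm (w (t + x))) \<in> borel_measurable lebesgue"
    using lebesgue_affine_measurable[where c = "\<lambda>x::real. 1" and t = t] Lp_loc_norm_measurable[OF assms]
    by (auto intro: measurable_compose[where g = "\<lambda>x. norm (w x)"])
qed

lemma Lp_loc_diff:
  assumes "1 \<le> p" "u \<in> Lp_loc p" "v \<in> Lp_loc p"
  shows "(\<lambda>s. u s - v s) \<in> Lp_loc p"
  using assms by (auto simp: Lp_loc_def intro!: Lp_diff_and_triangle(1))

text \<open>Translation invariance of Lebesgue measure. It moves windows starting at t to the fixed
  interval (0,1), where the Bochner transform takes its values.\<close>

lemma Lp_mass_translate:
  assumes w: "(\<lambda>x. norm (w x)) \<in> borel_measurable lebesgue" and E: "E \<in> sets lebesgue"
  shows "Lp_mass p E w = Lp_mass p ((+) (- t) ` E) (\<lambda>\<theta>. w (t + \<theta>))"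
proof -
  note [measurable] = w E
  have ind: "indicator E (t + \<theta>) = (indicator ((+) (- t) ` E) \<theta> :: ennreal)" for \<theta>
    by (force split: split_indicator)
  have "Lp_mass p E w = ennreal \<bar>1\<bar> *
      (\<integral>\<^sup>+x. ennreal (norm (w (t + 1 * x)) powr p) * indicator E (t + 1 * x) \<partial>lebesgue)"
    unfolding Lp_mass_def by (rule nn_integral_real_affine_lebesgue) auto
  then show ?thesis by (simp add: Lp_mass_def ind)
qed

lemma Lp_mass_unit_interval_translate:
  assumes "w \<in> Lp_loc p"
  shows "Lp_mass p {t<..<t + 1} w = Lp_mass p {0<..<1} (\<lambda>\<theta>. w (t + \<theta>))"
proof -
  have eq: "(+) (- t) ` {t<..<t + 1} = {0<..<1}"
  proof (intro equalityI subsetI)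
    fix x :: real assume "x \<in> {0<..<1}"
    then show "x \<in> (+) (- t) ` {t<..<t + 1}"
      by (intro image_eqI[of _ _ "t + x"]) auto
  qed auto
  then show ?thesis
    using Lp_mass_translate[OF Lp_loc_norm_measurable[OF assms], of "{t<..<t + 1}" p t]
    unfolding eq by simp
qed

lemma ennreal_Lp_norm_powr:
  assumes p: "1 \<le> p" and S: "S \<in> sets lebesgue" and f: "f \<in> Lp_functions p S"
  shows "ennreal (Lp_norm p S f powr p) = Lp_mass p S f"
  unfolding Lp_norm_powr[OF p] Lp_mass_lebesgue_on[OF S]
  using f by (intro nn_integral_eq_integral[symmetric]) (auto simp: Lp_functions_def)

text \<open>\<open>Lp_norm\<close> uses a real-valued integral, so finiteness must be known before
  passing to \<open>ennreal\<close>; it is carried over from \<open>w\<close> on (t, t + 1). Working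
  with the norm alone avoids transporting strong measurability along a translation.\<close>

lemma ennreal_Lp_norm_translate_powr:
  assumes p: "1 \<le> p" and w: "w \<in> Lp_loc p"
  shows "ennreal (Lp_norm p {0<..<1} (\<lambda>\<theta>. w (t + \<theta>)) powr p) = Lp_mass p {t<..<t + 1} w"
proof -
  have "w \<in> Lp_functions p {t<..<t + 1}" using w by (simp add: Lp_loc_def)
  then have "Lp_mass p {t<..<t + 1} w < \<infinity>"
    by (simp add: ennreal_Lp_norm_powr[OF p, symmetric])
  then have fin: "Lp_mass p {0<..<1} (\<lambda>\<theta>. w (t + \<theta>)) < \<infinity>"
    by (simp add: Lp_mass_unit_interval_translate[OF w])
  note [measurable] = Lp_loc_norm_translate_measurable_on[OF w]
  have "Lp_norm p {0<..<1} (\<lambda>\<theta>. w (t + \<theta>)) powr p = enn2real (Lp_mass p {0<..<1} (\<lambda>\<theta>. w (t + \<theta>)))"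
    unfolding Lp_norm_powr[OF p] by (subst integral_eq_nn_integral) (auto simp: Lp_mass_lebesgue_on)
  then show ?thesis
    using fin by (simp add: Lp_mass_unit_interval_translate[OF w])
qed

section \<open>Limits of suprema as uniform bounds\<close>

text \<open>The bound is non-strict because only such a bound on a supremum is equivalent, through
  \<open>SUP_le_iff\<close>, to the same bound on every member.\<close>

lemma ennreal_tendsto_0_iff_eventually_le:
  fixes f :: "'b \<Rightarrow> ennreal"
  shows "(f \<longlongrightarrow> 0) F \<longleftrightarrow> (\<forall>e::real. 0 < e \<longrightarrow> (\<forall>\<^sub>F x in F. f x \<le> ennreal e))"
proof
  assume *: "(f \<longlongrightarrow> 0) F"
  have "\<forall>\<^sub>F x in F. f x \<le> ennreal e" if "0 < e" for e
    using order_tendstoD(2)[OF *, of "ennreal e"] that by (auto elim: eventually_mono)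
  then show "\<forall>e::real. 0 < e \<longrightarrow> (\<forall>\<^sub>F x in F. f x \<le> ennreal e)"
    by blast
next
  assume *: "\<forall>e::real. 0 < e \<longrightarrow> (\<forall>\<^sub>F x in F. f x \<le> ennreal e)"
  show "(f \<longlongrightarrow> 0) F"
  proof (rule tendsto_zero_ennreal)
    fix r :: real assume r: "0 < r"
    then have "\<forall>\<^sub>F x in F. f x \<le> ennreal (r / 2)" using * by simp
    then show "\<forall>\<^sub>F x in F. f x < ennreal r"
      by eventually_elim (use r in \<open>auto elim!: order.strict_trans1 simp: ennreal_less_iff\<close>)
  qed
qed

lemma ennreal_tendsto_0_mono:
  fixes f g :: "'b \<Rightarrow> ennreal"
  assumes "\<And>x. f x \<le> g x" "(g \<longlongrightarrow> 0) F"
  shows "(f \<longlongrightarrow> 0) F"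
  unfolding ennreal_tendsto_0_iff_eventually_le
proof (intro allI impI)
  fix e :: real assume "0 < e"
  then have "\<forall>\<^sub>F x in F. g x \<le> ennreal e"
    using assms(2) by (simp add: ennreal_tendsto_0_iff_eventually_le)
  then show "\<forall>\<^sub>F x in F. f x \<le> ennreal e"
    by (rule eventually_mono) (rule order_trans[OF assms(1)])
qed

lemma small_sets_mono: "\<delta> \<le> d \<Longrightarrow> small_sets t \<delta> \<subseteq> small_sets t d"
  by (auto simp: small_sets_def intro: order_trans ennreal_leI)

text \<open>\<open>small_sets\<close> grows with \<delta>, so a bound valid for one positive
  \<delta> holds for all smaller ones, and the limit at 0 from the right reduces to the existence of
  one \<delta>.\<close>

lemma Stepanov_uniformly_integrable_iff:
  "Stepanov_uniformly_integrable p H \<longleftrightarrow> H \<subseteq> Lp_loc p \<and>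
     (\<forall>e>0. \<exists>\<delta>>0. \<forall>u\<in>H. \<forall>t. \<forall>E\<in>small_sets t \<delta>. Lp_mass p E u \<le> ennreal e)"
proof -
  let ?P = "\<lambda>e \<delta>. \<forall>u\<in>H. \<forall>t. \<forall>E\<in>small_sets t \<delta>. Lp_mass p E u \<le> ennreal e"
  have "(\<forall>\<^sub>F \<delta> in at_right 0. ?P e \<delta>) \<longleftrightarrow> (\<exists>\<delta>>0. ?P e \<delta>)" for e
  proof
    assume "\<forall>\<^sub>F \<delta> in at_right 0. ?P e \<delta>"
    then obtain b where b: "0 < b" "\<And>y. 0 < y \<Longrightarrow> y < b \<Longrightarrow> ?P e y"
      unfolding eventually_at_right_field by blast
    have "0 < b / 2" "?P e (b / 2)" using b(1) by (simp, intro b(2)) simp_all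
    then show "\<exists>\<delta>>0. ?P e \<delta>" by blast
  next
    assume "\<exists>\<delta>>0. ?P e \<delta>"
    then obtain d where d: "0 < d" "?P e d" by blast
    have "?P e y" if "y < d" for y
      using d(2) small_sets_mono[of y d] that by (meson less_imp_le subsetD)
    then show "\<forall>\<^sub>F \<delta> in at_right 0. ?P e \<delta>"
      unfolding eventually_at_right_field by (intro exI[of _ d] conjI d(1) allI impI)
  qed
  then show ?thesis
    unfolding Stepanov_uniformly_integrable_def ennreal_tendsto_0_iff_eventually_le
    by (simp add: SUP_le_iff flip: Lp_mass_def)
qed

lemma powr_le_cancel_iff_base:
  fixes a b p :: real
  assumes "0 < p" "0 \<le> a" "0 \<le> b"
  shows "a powr p \<le> b powr p \<longleftrightarrow> a \<le> b"
  using assms by (meson less_imp_le not_le powr_less_mono2 powr_mono2)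

text \<open>A bound e on the Stepanov norm is a bound e^p on the masses of all unit windows, and e^p
  runs through all positive reals, with inverse \<open>e powr (1 / p)\<close>.\<close>

lemma Stepanov_norm_tendsto_0_iff:
  assumes p: "1 \<le> p" and w: "\<And>k. w k \<in> Lp_loc p"
  shows "((\<lambda>k. Stepanov_norm p (w k)) \<longlongrightarrow> 0) F \<longleftrightarrow>
    (\<forall>e>0. \<forall>\<^sub>F k in F. \<forall>t. Lp_mass p {t<..<t + 1} (w k) \<le> ennreal e)"
proof -
  have le_iff: "Stepanov_norm p (w k) \<le> ennreal e \<longleftrightarrow> (\<forall>t. Lp_mass p {t<..<t + 1} (w k) \<le> ennreal (e powr p))"
    if "0 < e" for k e
    using p that
    by (simp add: Stepanov_norm_def SUP_le_iff powr_le_cancel_iff_base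
        flip: ennreal_Lp_norm_translate_powr[OF p w])
  show ?thesis
    unfolding ennreal_tendsto_0_iff_eventually_le
  proof (intro iffI allI impI)
    fix e :: real assume e: "0 < e"
      and H: "\<forall>e>0. \<forall>\<^sub>F k in F. Stepanov_norm p (w k) \<le> ennreal e"
    have "0 < e powr (1 / p)" "(e powr (1 / p)) powr p = e"
      using e p by (auto simp: powr_powr)
    then show "\<forall>\<^sub>F k in F. \<forall>t. Lp_mass p {t<..<t + 1} (w k) \<le> ennreal e"
      using H[rule_format, of "e powr (1 / p)"] by (simp add: le_iff)
  next
    fix e :: real assume e: "0 < e"
      and H: "\<forall>e>0. \<forall>\<^sub>F k in F. \<forall>t. Lp_mass p {t<..<t + 1} (w k) \<le> ennreal e"
    then show "\<forall>\<^sub>F k in F. Stepanov_norm p (w k) \<le> ennreal e"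
      by (simp add: le_iff)
  qed
qed

section \<open>Uniform integrability of a single almost automorphic function\<close>

text \<open>\<open>Lp_class p S f\<close> is defined for every \<open>f\<close> but may be empty.
  Lying in \<open>Lp_space\<close> provides a member g, equal to f almost everywhere, whose
  approximating simple functions and integrability pass to f.\<close>

lemma Lp_functions_if_class_in_space:
  fixes f :: "real \<Rightarrow> 'a::banach"
  assumes S: "S \<in> sets lebesgue" and f: "Lp_class p S f \<in> Lp_space p S"
    and m: "(\<lambda>x. norm (f x)) \<in> borel_measurable (lebesgue_on S)"
  shows "f \<in> Lp_functions p S"
proof -
  obtain g where g: "g \<in> Lp_functions p S" and eq: "Lp_class p S f = Lp_class p S g"
    using f by (auto simp: Lp_space_def)
  have "g \<in> Lp_class p S f" using g by (simp add: eq, simp add: Lp_class_def)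
  then have ae: "AE x in lebesgue_on S. g x = f x" by (simp add: Lp_class_def)
  obtain s where s: "\<And>n::nat. simple_function (lebesgue_on S) (s n)"
    and ls: "AE x in lebesgue_on S. (\<lambda>n. s n x) \<longlonglongrightarrow> g x"
    using g unfolding Lp_functions_def Bochner_measurable_on_def by blast
  have "AE x in lebesgue_on S. (\<lambda>n. s n x) \<longlonglongrightarrow> f x"
    using ls ae by eventually_elim simp
  then have "Bochner_measurable_on S f"
    using s unfolding Bochner_measurable_on_def by blast
  moreover have "integrable (lebesgue_on S) (\<lambda>x. norm (f x) powr p)"
  proof -
    have "integrable (lebesgue_on S) (\<lambda>x. norm (g x) powr p)"
      using g by (simp add: Lp_functions_def)
    moreover have "AE x in lebesgue_on S. norm (g x) powr p = norm (f x) powr p"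
      using ae by eventually_elim simp
    moreover have "(\<lambda>x. norm (f x) powr p) \<in> borel_measurable (lebesgue_on S)"
      using m by measurable
    ultimately show ?thesis
      using integrable_cong_AE_imp by blast
  qed
  ultimately show ?thesis by (simp add: Lp_functions_def)
qed

text \<open>Split w_k = (w_k - g) + g. The mass of the first term is bounded by that over all of
  \<open>S\<close>, which vanishes by L^p convergence; the second involves the single function g, so
  absolute continuity applies.\<close>

lemma Lp_mass_subset_tendsto_0:
  fixes w :: "nat \<Rightarrow> real \<Rightarrow> 'a::banach"
  assumes p: "1 \<le> p" and S: "S \<in> sets lebesgue"
    and w: "\<And>k. w k \<in> Lp_functions p S" and g: "g \<in> Lp_functions p S"
    and lim: "(\<lambda>k. Lp_norm p S (\<lambda>x. w k x - g x)) \<longlonglongrightarrow> 0"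
    and E: "\<And>k. E k \<in> sets lebesgue" "\<And>k. E k \<subseteq> S"
    and small: "(\<lambda>k. emeasure lebesgue (E k)) \<longlonglongrightarrow> 0"
  shows "(\<lambda>k. Lp_mass p (E k) (w k)) \<longlonglongrightarrow> 0"
proof -
  have wg: "(\<lambda>x. w k x - g x) \<in> Lp_functions p S" for k
    by (intro Lp_diff_and_triangle(1) p S w g)
  have mS: "(\<lambda>x. norm (f x)) \<in> borel_measurable (lebesgue_on S)" if "f \<in> Lp_functions p S" for f :: "real \<Rightarrow> 'a"
    using that S by (intro Bochner_measurable_on_norm) (auto simp: Lp_functions_def)
  have mE: "(\<lambda>x. norm (f x)) \<in> borel_measurable (lebesgue_on (E k))" if "f \<in> Lp_functions p S" for f :: "real \<Rightarrow> 'a" and k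
    using mS[OF that] E(2) by (rule measurable_restrict_mono)
  have "(\<lambda>k. Lp_norm p S (\<lambda>x. w k x - g x) powr p) \<longlonglongrightarrow> 0 powr p"
    using lim p by (intro tendsto_powr2 tendsto_const) auto
  then have "(\<lambda>k. ennreal (Lp_norm p S (\<lambda>x. w k x - g x) powr p)) \<longlonglongrightarrow> 0"
    using p by (simp add: ennreal_tendsto_0_iff)
  then have diff: "(\<lambda>k. Lp_mass p S (\<lambda>x. w k x - g x)) \<longlonglongrightarrow> 0"
    by (simp only: ennreal_Lp_norm_powr[OF p S wg])
  have single: "(\<lambda>k. Lp_mass p (E k) g) \<longlonglongrightarrow> 0"
    unfolding ennreal_tendsto_0_iff_eventually_le
  proof (intro allI impI)
    fix e :: real assume e: "0 < e"
    \<comment> \<open>Measurability of the norm of g is known on \<open>S\<close> only; extending by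
      0 leaves the masses over subsets of \<open>S\<close> unchanged.\<close>
    have [measurable]: "(\<lambda>x. if x \<in> S then norm (g x) else 0) \<in> borel_measurable lebesgue"
      using mS[OF g] S by (intro borel_measurable_if_I)
    let ?h = "\<lambda>x. ennreal ((if x \<in> S then norm (g x) else 0) powr p)"
    have "(\<integral>\<^sup>+x. ?h x \<partial>lebesgue) = Lp_mass p S g"
      unfolding Lp_mass_def by (intro nn_integral_cong) (auto split: split_indicator)
    also have "\<dots> < \<infinity>"
      by (simp flip: ennreal_Lp_norm_powr[OF p S g])
    finally have fin: "(\<integral>\<^sup>+x. ?h x \<partial>lebesgue) < \<infinity>" .
    have hm: "?h \<in> borel_measurable lebesgue" by measurable
    obtain \<delta> where d: "0 < \<delta>" "\<And>E. E \<in> sets lebesgue \<Longrightarrow> emeasure lebesgue E \<le> ennreal \<delta>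
        \<Longrightarrow> (\<integral>\<^sup>+x\<in>E. ?h x \<partial>lebesgue) \<le> ennreal e"
      using nn_integral_small_on_small_sets[OF hm fin e] by blast
    have eq: "Lp_mass p (E k) g = (\<integral>\<^sup>+x\<in>E k. ?h x \<partial>lebesgue)" for k
      unfolding Lp_mass_def using E(2)[of k] by (intro nn_integral_cong) (auto split: split_indicator)
    have "\<forall>\<^sub>F k in sequentially. emeasure lebesgue (E k) \<le> ennreal \<delta>"
      using small d(1) by (simp add: ennreal_tendsto_0_iff_eventually_le)
    then show "\<forall>\<^sub>F k in sequentially. Lp_mass p (E k) g \<le> ennreal e"
      by eventually_elim (simp add: eq d(2) E(1))
  qed
  have "(\<lambda>k. ennreal (2 powr p) * (Lp_mass p S (\<lambda>x. w k x - g x) + Lp_mass p (E k) g))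
      \<longlonglongrightarrow> ennreal (2 powr p) * (0 + 0)"
    by (intro ennreal_tendsto_cmult tendsto_add diff single) simp
  then have lim0: "(\<lambda>k. ennreal (2 powr p) * (Lp_mass p S (\<lambda>x. w k x - g x) + Lp_mass p (E k) g)) \<longlonglongrightarrow> 0"
    by simp
  have "Lp_mass p (E k) (w k) \<le> ennreal (2 powr p) * (Lp_mass p S (\<lambda>x. w k x - g x) + Lp_mass p (E k) g)" for k
  proof -
    have "norm (w k x) \<le> norm (w k x - g x) + norm (g x)" for x
      using norm_triangle_sub[of "w k x" "g x"] by simp
    then have "Lp_mass p (E k) (w k)
        \<le> ennreal (2 powr p) * (Lp_mass p (E k) (\<lambda>x. w k x - g x) + Lp_mass p (E k) g)"
      by (intro Lp_mass_le_add p E mE wg g)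
    also have "\<dots> \<le> ennreal (2 powr p) * (Lp_mass p S (\<lambda>x. w k x - g x) + Lp_mass p (E k) g)"
      by (intro mult_left_mono add_right_mono Lp_mass_mono_set E) simp
    finally show ?thesis .
  qed
  then show ?thesis
    using lim0 by (rule ennreal_tendsto_0_mono)
qed

text \<open>Almost automorphy read at t = 0: the range of the Bochner transform is relatively
  sequentially compact in L^p(0,1). The limit class is replaced by a representative g, so that
  ordinary norms can be used.\<close>

lemma Sp_aa_translates_subsequence:
  fixes u :: "real \<Rightarrow> 'a::banach" and s :: "nat \<Rightarrow> real"
  assumes p: "1 \<le> p" and u: "u \<in> Sp_aa p"
  obtains r g where "strict_mono r" "g \<in> Lp_functions p {0<..<1}"
    "\<And>t. (\<lambda>\<theta>. u (t + \<theta>)) \<in> Lp_functions p {0<..<1}"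
    "(\<lambda>k. Lp_norm p {0<..<1} (\<lambda>\<theta>. u (s (r k) + \<theta>) - g \<theta>)) \<longlonglongrightarrow> 0"
proof -
  let ?S = "{0<..<1::real}"
  have S: "?S \<in> sets lebesgue" by simp
  interpret Metric_space "Lp_space p ?S :: (real \<Rightarrow> 'a) set set" "Lp_dist p ?S"
    by (rule Metric_space_Lp[OF S p])
  have ul: "u \<in> Lp_loc p" and aa: "almost_automorphic mtopology (Bochner_transform p u)"
    using u by (auto simp: Sp_aa_def Lp_topology_def)
  obtain r v where r: "strict_mono r"
    and lim: "\<forall>t. limitin mtopology (\<lambda>k. Bochner_transform p u (t + s (r k))) (v t) sequentially \<and>
      limitin mtopology (\<lambda>k. v (t - s (r k))) (Bochner_transform p u t) sequentially"
    using aa[unfolded almost_automorphic_def, THEN conjunct2, rule_format, of s] by (elim exE conjE)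
  have v: "limitin mtopology (\<lambda>k. Bochner_transform p u (s (r k))) (v 0) sequentially"
    using lim[THEN spec, of 0] by simp
  \<comment> \<open>Continuity into \<open>mtopology\<close> includes that values lie in the
    carrier; this yields that the translates are L^p functions.\<close>
  have mem: "Bochner_transform p u t \<in> Lp_space p ?S" for t
    using aa continuous_map_image_subset_topspace[of euclideanreal mtopology "Bochner_transform p u"]
    by (auto simp: almost_automorphic_def)
  have uL: "(\<lambda>\<theta>. u (t + \<theta>)) \<in> Lp_functions p ?S" for t
  proof (rule Lp_functions_if_class_in_space[OF S])
    show "Lp_class p ?S (\<lambda>\<theta>. u (t + \<theta>)) \<in> Lp_space p ?S"
      using mem by (simp add: Bochner_transform_def)
    show "(\<lambda>\<theta>. norm (u (t + \<theta>))) \<in> borel_measurable (lebesgue_on ?S)"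
      by (rule Lp_loc_norm_translate_measurable_on[OF ul])
  qed
  obtain g where g: "g \<in> Lp_functions p ?S" and vg: "v 0 = Lp_class p ?S g"
    using limitin_mspace[OF v] by (auto simp: Lp_space_def)
  have "(\<lambda>k. Lp_dist p ?S (Bochner_transform p u (s (r k))) (v 0)) \<longlonglongrightarrow> 0"
    using v by (simp add: limitin_metric_dist_null)
  then have "(\<lambda>k. Lp_norm p ?S (\<lambda>\<theta>. u (s (r k) + \<theta>) - g \<theta>)) \<longlonglongrightarrow> 0"
    by (simp add: vg Bochner_transform_def Lp_dist_class[OF S uL g])
  then show ?thesis using that r g uL by blast
qed

lemma Sp_aa_uniformly_integrable:
  fixes u :: "real \<Rightarrow> 'a::banach"
  assumes p: "1 \<le> p" and u: "u \<in> Sp_aa p"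
  shows "Stepanov_uniformly_integrable p {u}"
proof -
  have ul: "u \<in> Lp_loc p" using u by (simp add: Sp_aa_def)
  have "\<exists>\<delta>>0. \<forall>t. \<forall>E\<in>small_sets t \<delta>. Lp_mass p E u \<le> ennreal e" if e: "0 < e" for e
  proof (rule ccontr)
    assume neg: "\<not> ?thesis"
    have "\<exists>t E. E \<in> small_sets t (1 / real (Suc n)) \<and> \<not> Lp_mass p E u \<le> ennreal e" for n
    proof -
      have "0 < 1 / real (Suc n)" by simp
      then show ?thesis using neg by blast
    qed
    then obtain s E where E: "\<And>n. E n \<in> small_sets (s n) (1 / real (Suc n))"
      and big: "\<And>n. \<not> Lp_mass p (E n) u \<le> ennreal e"
      by metis
    obtain r g where r: "strict_mono r" and g: "g \<in> Lp_functions p {0<..<1}"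
      and uL: "\<And>t. (\<lambda>\<theta>. u (t + \<theta>)) \<in> Lp_functions p {0<..<1}"
      and lim: "(\<lambda>k. Lp_norm p {0<..<1} (\<lambda>\<theta>. u (s (r k) + \<theta>) - g \<theta>)) \<longlonglongrightarrow> 0"
      using Sp_aa_translates_subsequence[OF p u, of s] by blast
    \<comment> \<open>The bad sets, shifted into (0,1) to sit under the convergent
      translates.\<close>
    define D where "D k = (+) (- s (r k)) ` E (r k)" for k
    have Em: "E n \<in> sets lebesgue" for n using E[of n] by (simp add: small_sets_def)
    have "(\<lambda>k. Lp_mass p (D k) (\<lambda>\<theta>. u (s (r k) + \<theta>))) \<longlonglongrightarrow> 0"
    proof (rule Lp_mass_subset_tendsto_0[OF p _ uL g lim])
      show "D k \<in> sets lebesgue" for k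
        unfolding D_def by (intro lebesgue_sets_translation Em)
      show "D k \<subseteq> {0<..<1}" for k
        using E[of "r k"] by (force simp: D_def small_sets_def)
      have le: "emeasure lebesgue (D k) \<le> ennreal (1 / real (Suc k))" for k
      proof -
        have "emeasure lebesgue (D k) = emeasure lebesgue (E (r k))"
          using emeasure_lebesgue_affine[of 1 "- s (r k)" "E (r k)"]
          by (simp add: D_def add.commute[of "- s (r k)"] del: emeasure_completion)
        also have "\<dots> \<le> ennreal (1 / real (Suc (r k)))"
          using E[of "r k"] unfolding small_sets_def by blast
        \<comment> \<open>A strictly increasing \<open>r\<close> satisfies k <= r k.\<close>
        also have "\<dots> \<le> ennreal (1 / real (Suc k))"
          using seq_suble[OF r, of k] by (intro ennreal_leI) (simp add: field_simps)
        finally show ?thesis .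
      qed
      have "(\<lambda>k. ennreal (1 / real (Suc k))) \<longlonglongrightarrow> 0"
        using LIMSEQ_inverse_real_of_nat by (simp add: ennreal_tendsto_0_iff inverse_eq_divide)
      then show "(\<lambda>k. emeasure lebesgue (D k)) \<longlonglongrightarrow> 0"
        by (rule ennreal_tendsto_0_mono[OF le])
    qed simp
    then have "\<forall>\<^sub>F k in sequentially. Lp_mass p (D k) (\<lambda>\<theta>. u (s (r k) + \<theta>)) \<le> ennreal e"
      using e by (simp add: ennreal_tendsto_0_iff_eventually_le)
    then obtain k where "Lp_mass p (D k) (\<lambda>\<theta>. u (s (r k) + \<theta>)) \<le> ennreal e"
      by (auto simp: eventually_sequentially)
    then show False
      using big[of "r k"] Lp_mass_translate[OF Lp_loc_norm_measurable[OF ul] Em, of p "r k" "s (r k)"]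
      by (simp add: D_def)
  qed
  then show ?thesis using ul by (simp add: Stepanov_uniformly_integrable_iff)
qed

section \<open>Level sets of the norm, and the equivalence\<close>

lemma sets_lebesgue_norm_ge:
  assumes "(\<lambda>x. norm (f x)) \<in> borel_measurable lebesgue" "E \<in> sets lebesgue"
  shows "{x \<in> E. e \<le> norm (f x)} \<in> sets lebesgue"
proof -
  have "{x \<in> space lebesgue. e \<le> norm (f x)} \<in> sets lebesgue"
    using assms(1) by (intro borel_measurable_le) auto
  then have "E \<inter> {x \<in> space lebesgue. e \<le> norm (f x)} \<in> sets lebesgue"
    using assms(2) by blast
  also have "E \<inter> {x \<in> space lebesgue. e \<le> norm (f x)} = {x \<in> E. e \<le> norm (f x)}"
    by auto
  finally show ?thesis .
qed

text \<open>Markov's inequality for the p-th power of the norm, after the level condition is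
  rewritten as \<open>1 \<le> c * h\<close>.\<close>

lemma Lp_mass_Chebyshev:
  assumes p: "0 < p" and f: "(\<lambda>x. norm (f x)) \<in> borel_measurable lebesgue"
    and E: "E \<in> sets lebesgue" and e: "0 < e"
  shows "emeasure lebesgue {x \<in> E. e \<le> norm (f x)} \<le> ennreal (1 / e powr p) * Lp_mass p E f"
proof -
  note [measurable] = f E
  have "e \<le> norm (f x) \<longleftrightarrow> 1 \<le> ennreal (1 / e powr p) * ennreal (norm (f x) powr p)" for x
  proof -
    have "e \<le> norm (f x) \<longleftrightarrow> e powr p \<le> norm (f x) powr p"
      using p e by (simp add: powr_le_cancel_iff_base)
    also have "\<dots> \<longleftrightarrow> 1 \<le> 1 / e powr p * norm (f x) powr p"
      using e by (simp add: field_simps)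
    also have "\<dots> \<longleftrightarrow> 1 \<le> ennreal (1 / e powr p * norm (f x) powr p)"
      by (simp only: ennreal_ge_1)
    also have "ennreal (1 / e powr p * norm (f x) powr p)
        = ennreal (1 / e powr p) * ennreal (norm (f x) powr p)"
      by (rule ennreal_mult) simp_all
    finally show ?thesis .
  qed
  then show ?thesis
    unfolding Lp_mass_def by (simp only:) (rule nn_integral_Markov_inequality; measurable)
qed

text \<open>Below the level the integrand is at most e^p; the rest is kept as it is. On a window of
  length one the first term is at most e^p, uniformly in the position of the window.\<close>

lemma Lp_mass_le_level_split:
  assumes f: "(\<lambda>x. norm (f x)) \<in> borel_measurable lebesgue" and p: "0 < p"
    and E: "E \<in> sets lebesgue" and e: "0 \<le> e"
  shows "Lp_mass p E f \<le> ennreal (e powr p) * emeasure lebesgue E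
      + Lp_mass p {x \<in> E. e \<le> norm (f x)} f"
proof -
  note [measurable] = f E
  let ?A = "{x \<in> E. e \<le> norm (f x)}"
  have [measurable]: "?A \<in> sets lebesgue" by (rule sets_lebesgue_norm_ge[OF f E])
  have "Lp_mass p E f \<le> (\<integral>\<^sup>+x. ennreal (e powr p) * indicator E x
      + ennreal (norm (f x) powr p) * indicator ?A x \<partial>lebesgue)"
    unfolding Lp_mass_def using p
    by (intro nn_integral_mono) (auto split: split_indicator intro!: ennreal_leI powr_mono2)
  also have "\<dots> = ennreal (e powr p) * emeasure lebesgue E + Lp_mass p ?A f"
    unfolding Lp_mass_def by (subst nn_integral_add) (auto simp: nn_integral_cmult_indicator)
  finally show ?thesis .
qed

theorem corollary5p9:
  fixes p :: real
    and u :: "real \<Rightarrow> 'a::banach"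
    and uk :: "nat \<Rightarrow> real \<Rightarrow> 'a"
  assumes "1 \<le> p"
    and "u \<in> Sp_aa p"
    and "\<And>k. uk k \<in> Sp_aa p"
  shows "((\<lambda>k. Stepanov_norm p (\<lambda>s. uk k s - u s)) \<longlonglongrightarrow> 0) \<longleftrightarrow>
    (Stepanov_uniformly_integrable p (range uk) \<and>
     (\<forall>\<epsilon>>0. (\<lambda>k. SUP t. emeasure lebesgue {s \<in> {t<..<t + 1}. \<epsilon> \<le> norm (uk k s - u s)})
        \<longlonglongrightarrow> 0))"
proof -
  note p = assms(1)
  have ul: "u \<in> Lp_loc p" and ukl: "\<And>k. uk k \<in> Lp_loc p"
    using assms by (auto simp: Sp_aa_def)
  have dl: "(\<lambda>s. uk k s - u s) \<in> Lp_loc p" for k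
    by (intro Lp_loc_diff p ul ukl)
  have uUI: "\<exists>\<delta>>0. \<forall>t. \<forall>E\<in>small_sets t \<delta>. Lp_mass p E u \<le> ennreal e" if "0 < e" for e
    using Sp_aa_uniformly_integrable[OF p assms(2)] that
    by (simp add: Stepanov_uniformly_integrable_iff)
  let ?A = "\<lambda>k t \<epsilon>. {s \<in> {t<..<t + 1}. \<epsilon> \<le> norm (uk k s - u s)}"
  have norm_iff: "((\<lambda>k. Stepanov_norm p (\<lambda>s. uk k s - u s)) \<longlonglongrightarrow> 0) \<longleftrightarrow>
    (\<forall>e>0. \<forall>\<^sub>F k in sequentially. \<forall>t. Lp_mass p {t<..<t + 1} (\<lambda>s. uk k s - u s) \<le> ennreal e)"
    by (rule Stepanov_norm_tendsto_0_iff[OF p dl])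
  have meas_iff: "((\<lambda>k. SUP t. emeasure lebesgue (?A k t \<epsilon>)) \<longlonglongrightarrow> 0) \<longleftrightarrow>
    (\<forall>e>0. \<forall>\<^sub>F k in sequentially. \<forall>t. emeasure lebesgue (?A k t \<epsilon>) \<le> ennreal e)" for \<epsilon>
    by (simp add: ennreal_tendsto_0_iff_eventually_le SUP_le_iff)
  \<comment> \<open>The tolerance for each of the two terms in \<open>Lp_mass_le_add\<close>,
    absorbing its constant 2^p.\<close>
  have halves: "ennreal (2 powr p) * (ennreal (e / (2 * 2 powr p)) + ennreal (e / (2 * 2 powr p))) = ennreal e"
    if "0 < e" for e
    using that by (simp flip: ennreal_plus ennreal_mult')
  show ?thesis
  proof (intro iffI conjI allI impI)
    assume "(\<lambda>k. Stepanov_norm p (\<lambda>s. uk k s - u s)) \<longlonglongrightarrow> 0"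
    then have conv: "\<forall>\<^sub>F k in sequentially. \<forall>t. Lp_mass p {t<..<t + 1} (\<lambda>s. uk k s - u s) \<le> ennreal e"
      if "0 < e" for e
      using that by (simp add: norm_iff)
    \<comment> \<open>For k >= K, \<open>uk k\<close> is close to \<open>u\<close> on every window,
      so the \<delta> of \<open>u\<close> serves; each of the finitely many remaining functions has
      its own \<delta>.\<close>
    have "\<exists>\<delta>>0. \<forall>k t. \<forall>E\<in>small_sets t \<delta>. Lp_mass p E (uk k) \<le> ennreal e" if e: "0 < e" for e
    proof -
      define e' where "e' = e / (2 * 2 powr p)"
      have e': "0 < e'" using e by (simp add: e'_def)
      obtain K where K: "\<And>k t. K \<le> k \<Longrightarrow> Lp_mass p {t<..<t + 1} (\<lambda>s. uk k s - u s) \<le> ennreal e'"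
        using conv[OF e'] by (auto simp: eventually_sequentially)
      obtain d where d: "0 < d" "\<And>t E. E \<in> small_sets t d \<Longrightarrow> Lp_mass p E u \<le> ennreal e'"
        using uUI[OF e'] by blast
      have "\<exists>\<delta>>0. \<forall>t. \<forall>E\<in>small_sets t \<delta>. Lp_mass p E (uk k) \<le> ennreal e" for k
        using Sp_aa_uniformly_integrable[OF p assms(3)] e
        by (simp add: Stepanov_uniformly_integrable_iff)
      then obtain D where D: "\<And>k. 0 < D k"
        "\<And>k t E. E \<in> small_sets t (D k) \<Longrightarrow> Lp_mass p E (uk k) \<le> ennreal e"
        by metis
      \<comment> \<open>The set is nonempty even for K = 0, thanks to \<open>d\<close>.\<close>
      define \<delta> where "\<delta> = Min (insert d (D ` {..<K}))"
      have \<delta>: "0 < \<delta>" "\<delta> \<le> d" "\<And>k. k < K \<Longrightarrow> \<delta> \<le> D k"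
        using d(1) D(1) by (auto simp: \<delta>_def)
      have "Lp_mass p E (uk k) \<le> ennreal e" if E: "E \<in> small_sets t \<delta>" for k t E
      proof (cases "k < K")
        case True
        then show ?thesis using E \<delta>(3) D(2) small_sets_mono by blast
      next
        case False
        have Em: "E \<in> sets lebesgue" and Et: "E \<subseteq> {t<..<t + 1}"
          using E by (auto simp: small_sets_def)
        have "norm (uk k x) \<le> norm (uk k x - u x) + norm (u x)" for x
          using norm_triangle_sub[of "uk k x" "u x"] by simp
        then have "Lp_mass p E (uk k) \<le> ennreal (2 powr p) * (Lp_mass p E (\<lambda>s. uk k s - u s) + Lp_mass p E u)"
          by (intro Lp_mass_le_add p Em Lp_loc_norm_measurable_on[OF dl] Lp_loc_norm_measurable_on[OF ul])
        also have "\<dots> \<le> ennreal (2 powr p) * (ennreal e' + ennreal e')"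
        proof (intro mult_left_mono add_mono)
          show "Lp_mass p E (\<lambda>s. uk k s - u s) \<le> ennreal e'"
            using order_trans[OF Lp_mass_mono_set[OF Et] K] False by simp
          show "Lp_mass p E u \<le> ennreal e'"
            using E \<delta>(2) d(2) small_sets_mono by blast
        qed simp
        also have "\<dots> = ennreal e" unfolding e'_def by (rule halves[OF e])
        finally show ?thesis .
      qed
      then show ?thesis using \<delta>(1) by blast
    qed
    then show "Stepanov_uniformly_integrable p (range uk)"
      using ukl by (auto simp: Stepanov_uniformly_integrable_iff)
    fix \<epsilon> :: real assume \<epsilon>: "0 < \<epsilon>"
    show "(\<lambda>k. SUP t. emeasure lebesgue (?A k t \<epsilon>)) \<longlonglongrightarrow> 0"
      unfolding meas_iff
    proof (intro allI impI)
      fix e :: real assume e: "0 < e"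
      \<comment> \<open>The mass bound that Chebyshev's inequality at level \<epsilon> turns into
        the measure bound e.\<close>
      have "0 < e * \<epsilon> powr p" using e \<epsilon> by simp
      from conv[OF this]
      show "\<forall>\<^sub>F k in sequentially. \<forall>t. emeasure lebesgue (?A k t \<epsilon>) \<le> ennreal e"
      proof (eventually_elim, intro allI)
        fix k t
        assume "\<forall>t. Lp_mass p {t<..<t + 1} (\<lambda>s. uk k s - u s) \<le> ennreal (e * \<epsilon> powr p)"
        then have "ennreal (1 / \<epsilon> powr p) * Lp_mass p {t<..<t + 1} (\<lambda>s. uk k s - u s)
            \<le> ennreal (1 / \<epsilon> powr p) * ennreal (e * \<epsilon> powr p)"
          by (intro mult_left_mono) auto
        also have "\<dots> = ennreal e"
          using \<epsilon> e by (simp flip: ennreal_mult')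
        finally show "emeasure lebesgue (?A k t \<epsilon>) \<le> ennreal e"
          using p \<epsilon> by (intro order_trans[OF Lp_mass_Chebyshev[OF _ Lp_loc_norm_measurable[OF dl]]]) auto
      qed
    qed
  next
    assume "Stepanov_uniformly_integrable p (range uk) \<and>
      (\<forall>\<epsilon>>0. (\<lambda>k. SUP t. emeasure lebesgue (?A k t \<epsilon>)) \<longlonglongrightarrow> 0)"
    then have UI: "\<exists>\<delta>>0. \<forall>k t. \<forall>E\<in>small_sets t \<delta>. Lp_mass p E (uk k) \<le> ennreal e"
      and conv: "\<forall>\<^sub>F k in sequentially. \<forall>t. emeasure lebesgue (?A k t \<epsilon>) \<le> ennreal e"
      if "0 < e" "0 < \<epsilon>" for e \<epsilon>
      using that unfolding meas_iff by (auto simp: Stepanov_uniformly_integrable_iff)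
    show "(\<lambda>k. Stepanov_norm p (\<lambda>s. uk k s - u s)) \<longlonglongrightarrow> 0"
      unfolding norm_iff
    proof (intro allI impI)
      fix e :: real assume e: "0 < e"
      \<comment> \<open>At this level the part below it contributes at most \<epsilon>^p = e / 2 on
        a unit window; \<open>e'\<close> below is tuned so that the part above it contributes at
        most e / 2 too.\<close>
      define \<epsilon> where "\<epsilon> = (e / 2) powr (1 / p)"
      have \<epsilon>: "0 < \<epsilon>" "\<epsilon> powr p = e / 2"
        using e p by (auto simp: \<epsilon>_def powr_powr)
      define e' where "e' = (e / 2) / (2 * 2 powr p)"
      have e': "0 < e'" using e by (simp add: e'_def)
      \<comment> \<open>\<open>zero_less_one\<close> discharges the positivity of \<epsilon>, a
        premise that \<open>UI\<close> shares with \<open>conv\<close>.\<close>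
      obtain d1 where d1: "0 < d1" "\<And>k t E. E \<in> small_sets t d1 \<Longrightarrow> Lp_mass p E (uk k) \<le> ennreal e'"
        using UI[OF e' zero_less_one] by blast
      obtain d2 where d2: "0 < d2" "\<And>t E. E \<in> small_sets t d2 \<Longrightarrow> Lp_mass p E u \<le> ennreal e'"
        using uUI[OF e'] by blast
      define \<delta> where "\<delta> = min d1 d2"
      have \<delta>: "0 < \<delta>" "\<delta> \<le> d1" "\<delta> \<le> d2" using d1 d2 by (auto simp: \<delta>_def)
      \<comment> \<open>Convergence in measure is applied with \<delta> as the tolerance: for large
        k every level set \<open>?A k t \<epsilon>\<close> is in
        \<open>small_sets t \<delta>\<close>, for all t at once.\<close>
      from conv[OF \<delta>(1) \<epsilon>(1)]
      show "\<forall>\<^sub>F k in sequentially. \<forall>t. Lp_mass p {t<..<t + 1} (\<lambda>s. uk k s - u s) \<le> ennreal e"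
      proof (eventually_elim, intro allI)
        fix k t
        assume small: "\<forall>t. emeasure lebesgue (?A k t \<epsilon>) \<le> ennreal \<delta>"
        have Am: "?A k t \<epsilon> \<in> sets lebesgue"
          by (intro sets_lebesgue_norm_ge Lp_loc_norm_measurable[OF dl]) simp
        moreover have "?A k t \<epsilon> \<subseteq> {t<..<t + 1}"
          by blast
        ultimately have A: "?A k t \<epsilon> \<in> small_sets t \<delta>"
          unfolding small_sets_def using small by blast
        have "Lp_mass p (?A k t \<epsilon>) (\<lambda>s. uk k s - u s)
            \<le> ennreal (2 powr p) * (Lp_mass p (?A k t \<epsilon>) (uk k) + Lp_mass p (?A k t \<epsilon>) u)"
          by (intro Lp_mass_le_add p Am Lp_loc_norm_measurable_on[OF ukl] Lp_loc_norm_measurable_on[OF ul]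
              norm_triangle_ineq4)
        also have "\<dots> \<le> ennreal (2 powr p) * (ennreal e' + ennreal e')"
        proof (intro mult_left_mono add_mono)
          show "Lp_mass p (?A k t \<epsilon>) (uk k) \<le> ennreal e'"
            using A \<delta>(2) d1(2) small_sets_mono by blast
          show "Lp_mass p (?A k t \<epsilon>) u \<le> ennreal e'"
            using A \<delta>(3) d2(2) small_sets_mono by blast
        qed simp
        also have "\<dots> = ennreal (e / 2)"
          unfolding e'_def using e by (intro halves) simp
        finally have large: "Lp_mass p (?A k t \<epsilon>) (\<lambda>s. uk k s - u s) \<le> ennreal (e / 2)" .
        have "Lp_mass p {t<..<t + 1} (\<lambda>s. uk k s - u s)
            \<le> ennreal (\<epsilon> powr p) * emeasure lebesgue {t<..<t + 1}
              + Lp_mass p (?A k t \<epsilon>) (\<lambda>s. uk k s - u s)"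
          using p \<epsilon>(1) by (intro Lp_mass_le_level_split Lp_loc_norm_measurable[OF dl]) auto
        also have "\<dots> \<le> ennreal (e / 2) + ennreal (e / 2)"
          using large by (intro add_mono) (simp_all add: \<epsilon>(2))
        also have "\<dots> = ennreal e"
          using e by (simp flip: ennreal_plus)
        finally show "Lp_mass p {t<..<t + 1} (\<lambda>s. uk k s - u s) \<le> ennreal e" .
      qed
    qed
  qed
qed

end
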